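(* Let $k\ge 3$ be an integer and let $\mu$ be the probability measure on $\left[1-\frac{2\sqrt{k-1}}{k},\,1+\frac{2\sqrt{k-1}}{k}\right]$ given by $$d\mu(\lambda)=\frac{k}{2\pi}\,\frac{\sqrt{\frac{4(k-1)}{k^2}-(1-\lambda)^2}}{1-(1-\lambda)^2}\,d\lambda .$$ Define $\delta_0=\frac{k}{k+1}$ and $\delta_t=\left(1-\frac{k-1}{k^2}\,\delta_{t-1}\right)^{-1}$ for $t\ge 1$. Then the sequence of residual orthogonal polynomials with respect to the weight $\lambda\,d\mu(\lambda)$ is the sequence $(Q_t)_{t\ge 0}$ defined by $$Q_0(\lambda)=1,\qquad Q_1(\lambda)=1-\delta_0\lambda,\qquad Q_{t+1}(\lambda)=\delta_t(1-\lambda)Q_t(\lambda)+(1-\delta_t)Q_{t-1}(\lambda)\quad (t\ge 1).$$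
   Context: A sequence of real polynomials $P_0,P_1,\dots$ is orthogonal with respect to a measure $d\alpha$ (for which all polynomials are integrable) if $P_t$ has degree $t$ for every $t$, $\int P_iP_j\,d\alpha=0$ whenever $i\ne j$, and $\int P_i^2\,d\alpha>0$ for every $i$. If in addition $P_t(0)=1$ for all $t$, the polynomials are called residual orthogonal polynomials. *)

theory Defs
  imports "HOL-Probability.Probability" "HOL-Computational_Algebra.Polynomial"
begin

definition orthogonal_polys :: "real measure \<Rightarrow> (nat \<Rightarrow> real poly) \<Rightarrow> bool" where
  "orthogonal_polys M P \<longleftrightarrow>
     (\<forall>p :: real poly. integrable M (poly p)) \<and>
     (\<forall>t. degree (P t) = t) \<and>
     (\<forall>i j. i \<noteq> j \<longrightarrow> (\<integral>x. poly (P i) x * poly (P j) x \<partial>M) = 0) \<and>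
     (\<forall>i. (\<integral>x. (poly (P i) x)\<^sup>2 \<partial>M) > 0)"

definition residual_orthogonal_polys :: "real measure \<Rightarrow> (nat \<Rightarrow> real poly) \<Rightarrow> bool" where
  "residual_orthogonal_polys M P \<longleftrightarrow> orthogonal_polys M P \<and> (\<forall>t. poly (P t) 0 = 1)"

text \<open>The measure on the interval is extended by zero to a Borel measure on the real line.\<close>

definition spectral_measure :: "nat \<Rightarrow> real measure" where
  "spectral_measure k = density lborel (\<lambda>x. ennreal
     (indicator {1 - 2 * sqrt (real k - 1) / real k .. 1 + 2 * sqrt (real k - 1) / real k} x *
      (real k / (2 * pi) *
       (sqrt (4 * (real k - 1) / (real k)\<^sup>2 - (1 - x)\<^sup>2) / (1 - (1 - x)\<^sup>2)))))"

text \<open>The measure with weight \<open>x\<close> relative to \<^term>\<open>spectral_measure k\<close>. The function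
  \<^const>\<open>ennreal\<close> truncates negative reals to 0, which is harmless since the support of
  \<^term>\<open>spectral_measure k\<close> lies in the nonnegative reals.\<close>

definition weighted_spectral_measure :: "nat \<Rightarrow> real measure" where
  "weighted_spectral_measure k = density (spectral_measure k) (\<lambda>x. ennreal x)"

primrec delta :: "nat \<Rightarrow> nat \<Rightarrow> real" where
  "delta k 0 = real k / (real k + 1)"
| "delta k (Suc t) = inverse (1 - (real k - 1) / (real k)\<^sup>2 * delta k t)"

fun Q :: "nat \<Rightarrow> nat \<Rightarrow> real poly" where
  "Q k 0 = 1"
| "Q k (Suc 0) = [:1, - delta k 0:]"
| "Q k (Suc (Suc t)) =
     smult (delta k (Suc t)) ([:1, -1:] * Q k (Suc t)) + smult (1 - delta k (Suc t)) (Q k t)"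

end

theory Submission imports Defs
begin

text \<open>
  Write \<open>c = 2 sqrt (k - 1) / k\<close> and \<open>r = 1 / sqrt (k - 1)\<close>, and substitute \<open>x = 1 - c cos \<theta>\<close>. Since
  \<open>1 - (1 - x)\<^sup>2 = x (2 - x)\<close>, the weight \<open>x\<close> cancels one factor of the denominator of the density, and
  since \<open>(1 + r\<^sup>2) (1 + c cos \<theta>) = 1 + r\<^sup>2 + 2 r cos \<theta>\<close>, the weighted measure becomes
  \<open>(2 / \<pi>) sin\<^sup>2 \<theta> / (1 + r\<^sup>2 + 2 r cos \<theta>) d\<theta>\<close>: a Chebyshev weight of the second kind divided by a
  polynomial of degree one. For such weights of Bernstein-Szego type the orthogonal polynomials
  are multiples of \<open>U\<^sub>n + r U\<^sub>n\<^sub>-\<^sub>1\<close>, with \<open>U\<^sub>n\<close> the Chebyshev polynomials of the second kind, and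
  the recursion for \<open>\<delta>\<close> is exactly what makes the multiples normalised to 1 at \<open>x = 0\<close> satisfy
  the given recurrence (\<open>Q_trigonometric\<close>).

  By Favard's argument, orthogonality of a sequence with a three-term recurrence needs only that the
  integrals of all its members of positive degree vanish (\<open>recurrence_annihilates_lower_degree\<close>), and
  the signs of the recurrence coefficients then decide that the squared norms are positive
  (\<open>recurrence_norm\<close>). So everything comes down to the integrals
  \<open>E\<^sub>n = \<integral> sin \<theta> (sin ((n + 1) \<theta>) + r sin (n \<theta>)) / (1 + r\<^sup>2 + 2 r cos \<theta>) d\<theta>\<close> over \<open>[0, \<pi>]\<close>. They satisfy
  \<open>r E\<^sub>n\<^sub>+\<^sub>1 + E\<^sub>n = 0\<close> for \<open>n > 0\<close>. As \<open>\<bar>r\<bar> < 1\<close>, a nonzero solution would grow geometrically, whereas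
  the \<open>E\<^sub>n\<close> are bounded; hence \<open>E\<^sub>n = 0\<close> for \<open>n > 0\<close>, and \<open>r E\<^sub>1 + E\<^sub>0 = \<pi> / 2\<close> gives
  \<open>E\<^sub>0 = \<pi> / 2\<close>. The total mass of the
  unweighted measure splits by partial fractions into two instances of \<open>E\<^sub>0\<close>, for \<open>r\<close> and \<open>- r\<close>.

  Uniqueness holds because polynomials orthogonal for the same measure agree up to scalars, which the
  value 1 at the origin fixes.
\<close>

section \<open>Orthogonality and three-term recurrences\<close>

text \<open>Orthogonality with respect to a measure involves the measure only through the functional
  \<open>p \<mapsto> \<integral> p\<close>, so the algebraic part of the argument is carried out for any linear functional.\<close>

locale poly_functional =
  fixes L :: "real poly \<Rightarrow> real"
  assumes add: "L (p + q) = L p + L q"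
    and smult: "L (smult c p) = c * L p"
begin

lemma zero [simp]: "L 0 = 0"
  using smult[of 0 0] by simp

lemma diff: "L (p - q) = L p - L q"
  using add[of p "smult (-1) q"] smult[of "-1" q] by simp

lemma uminus: "L (- p) = - L p"
  using diff[of 0 p] by simp

lemma recurrence_degree:
  fixes P :: "nat \<Rightarrow> real poly"
  assumes "P 0 = 1" "P 1 = [:b 0, a 0:]"
    and "\<And>n. P (n + 2) = [:b (n + 1), a (n + 1):] * P (n + 1) + smult (c n) (P n)"
    and "\<And>n. a n \<noteq> (0::real)"
  shows "degree (P n) = n"
proof (induction n rule: less_induct)
  case (less n)
  consider "n = 0" | "n = 1" | m where "n = m + 2"
    by (metis One_nat_def add_2_eq_Suc' not0_implies_Suc)
  then show ?case
  proof cases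
    case 3
    have d: "degree (P (m + 1)) = m + 1" "degree (P m) = m"
      using less 3 by auto
    then have "P (m + 1) \<noteq> 0" by auto
    then have "degree ([:b (m + 1), a (m + 1):] * P (m + 1)) = m + 2"
      using assms(4)[of "m + 1"] d by (subst degree_mult_eq) auto
    moreover have "degree (smult (c m) (P m)) < m + 2"
      using d by simp
    ultimately show ?thesis
      using 3 assms(3)[of m] degree_add_eq_left by metis
  qed (use assms(1,2) assms(4)[of 0] in auto)
qed

text \<open>The argument behind Favard's theorem: the recurrence expresses \<open>x P\<^sub>n\<close> through \<open>P\<^sub>n\<^sub>+\<^sub>1\<close>, \<open>P\<^sub>n\<close> and
  \<open>P\<^sub>n\<^sub>-\<^sub>1\<close>, so the factors \<open>x\<close> of \<open>p\<close> can be absorbed one at a time. Each of them lowers the index by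
  at most one, and as \<open>p\<close> has degree below \<open>n\<close> the index never reaches 0, where the functional
  need not vanish.\<close>

lemma recurrence_annihilates_lower_degree:
  fixes P :: "nat \<Rightarrow> real poly"
  assumes rec: "\<And>n. P (n + 2) = [:b (n + 1), a (n + 1):] * P (n + 1) + smult (c n) (P n)"
    and a: "\<And>n. a n \<noteq> (0::real)"
    and vanish: "\<And>n. n > 0 \<Longrightarrow> L (P n) = 0"
    and deg: "degree p < n"
  shows "L (p * P n) = 0"
  using deg
proof (induction p arbitrary: n rule: pCons_induct)
  case (pCons u p)
  have *: "pCons u p * P n = smult u (P n) + p * ([:0, 1:] * P n)"
    by (simp add: algebra_simps)
  show ?case
  proof (cases "p = 0")
    case True
    then show ?thesis using pCons.prems by (simp add: * smult vanish)
  next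
    case False
    then obtain m where n: "n = m + 1" "degree p < m"
      using pCons.prems by (cases n) auto
    have "smult (a (m + 1)) ([:0, 1:] * P (m + 1))
        = P (m + 2) - smult (b (m + 1)) (P (m + 1)) - smult (c m) (P m)"
      by (subst rec) (simp add: algebra_simps)
    then have "smult (a (m + 1)) (p * ([:0, 1:] * P (m + 1)))
        = p * P (m + 2) - smult (b (m + 1)) (p * P (m + 1)) - smult (c m) (p * P m)"
      by (metis mult_smult_right right_diff_distrib)
    then have "a (m + 1) * L (p * ([:0, 1:] * P (m + 1))) = 0"
      using pCons.IH[of "m + 2"] pCons.IH[of "m + 1"] pCons.IH[of m] n(2)
      by (simp flip: smult add: diff) (simp add: smult)
    then have "L (p * ([:0, 1:] * P n)) = 0"
      using a[of "m + 1"] n by simp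
    then show ?thesis
      using n by (simp add: * add smult vanish)
  qed
qed auto

text \<open>Both sides are multiples of \<open>L (x P\<^sub>n P\<^sub>n\<^sub>+\<^sub>1)\<close>: expanding \<open>x P\<^sub>n\<close> gives the left one, expanding
  \<open>x P\<^sub>n\<^sub>+\<^sub>1\<close> the right one, all other terms being killed by orthogonality. In particular the
  positivity of the norms can be read off from the signs of the coefficients.\<close>

lemma recurrence_norm:
  fixes P :: "nat \<Rightarrow> real poly"
  assumes P0: "P 0 = 1" and P1: "P 1 = [:b 0, a 0:]"
    and rec: "\<And>n. P (n + 2) = [:b (n + 1), a (n + 1):] * P (n + 1) + smult (c n) (P n)"
    and a: "\<And>n. a n \<noteq> (0::real)"
    and vanish: "\<And>n. n > 0 \<Longrightarrow> L (P n) = 0"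
  shows "L (P (n + 1) * P (n + 1)) = - (a n * c n / a (n + 1)) * L (P n * P n)"
proof -
  have deg: "degree (P n) = n" for n
    using recurrence_degree[of P b a c, OF P0 P1 rec a] .
  have ann: "L (p * P n) = 0" if "degree p < n" for p n
    using recurrence_annihilates_lower_degree[of P b a c, OF rec a vanish that] by simp
  define X where "X = ([:0, 1:] :: real poly)"
  have "\<exists>R. P (n + 1) = smult (a n) (X * P n) + R \<and> degree R < n + 1"
  proof (cases n)
    case 0
    then show ?thesis using P0 P1 by (intro exI[of _ "[:b 0:]"]) (auto simp: X_def)
  next
    case (Suc m)
    have "P (n + 1) = smult (a n) (X * P n) + (smult (b n) (P n) + smult (c m) (P m))"
      using rec[of m] Suc by (simp add: X_def algebra_simps)
    moreover have "degree (smult (b n) (P n) + smult (c m) (P m)) < n + 1"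
      by (intro degree_add_less) (use deg Suc in auto)
    ultimately show ?thesis by blast
  qed
  then obtain R where R: "P (n + 1) = smult (a n) (X * P n) + R" "degree R < n + 1"
    by blast
  have "L (P (n + 1) * P (n + 1)) = L (smult (a n) (X * P n * P (n + 1)) + R * P (n + 1))"
    by (subst (1) R(1)) (simp add: algebra_simps)
  also have "\<dots> = a n * L (X * P n * P (n + 1))"
    using ann R(2) by (simp add: add smult)
  finally have 1: "L (P (n + 1) * P (n + 1)) = a n * L (X * P n * P (n + 1))" .
  have "smult (a (n + 1)) (X * P n * P (n + 1))
      = P n * P (n + 2) - smult (b (n + 1)) (P n * P (n + 1)) - smult (c n) (P n * P n)"
    by (subst rec) (simp add: X_def algebra_simps)
  then have "a (n + 1) * L (X * P n * P (n + 1)) = - c n * L (P n * P n)"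
    using ann deg by (simp flip: smult add: diff) (simp add: smult uminus)
  then show ?thesis
    using 1 a[of "n + 1"] by (simp add: field_simps)
qed

lemma graded_basis:
  fixes P :: "nat \<Rightarrow> real poly"
  assumes "\<And>i. degree (P i) = i" "P 0 \<noteq> 0" "degree p < n"
  shows "\<exists>c. p = (\<Sum>i<n. smult (c i) (P i))"
  using assms(3)
proof (induction n arbitrary: p)
  case (Suc n)
  define s where "s = coeff p n / coeff (P n) n"
  have nz: "coeff (P n) n \<noteq> 0"
    using assms(1)[of n] assms(2) by (metis degree_0 leading_coeff_0_iff)
  define R where "R = p - smult s (P n)"
  have R: "degree R \<le> n" "coeff R n = 0"
    using Suc.prems assms(1)[of n] nz
    by (auto simp: R_def s_def intro!: degree_diff_le order.trans[OF degree_smult_le])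
  have "\<exists>c. R = (\<Sum>i<n. smult (c i) (P i))"
  proof (cases "R = 0")
    case True
    then show ?thesis by (intro exI[of _ "\<lambda>_. 0"]) simp
  next
    case False
    then have "degree R < n"
      using R by (metis le_neq_implies_less leading_coeff_0_iff)
    then show ?thesis by (rule Suc.IH)
  qed
  then obtain c where c: "R = (\<Sum>i<n. smult (c i) (P i))" by blast
  have "p = (\<Sum>i<Suc n. smult ((c(n := s)) i) (P i))"
    using c by (simp add: R_def algebra_simps)
  then show ?case by blast
qed simp

lemma sum: "L (\<Sum>i\<in>A. f i) = (\<Sum>i\<in>A. L (f i))"
  by (induction A rule: infinite_finite_induct) (auto simp: add)

text \<open>Expand \<open>P'\<^sub>n\<close> in the \<open>P\<^sub>i\<close>. The coefficient at \<open>i < n\<close> is detected by multiplying with \<open>P\<^sub>i\<close>, which is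
  itself a combination of the \<open>P'\<^sub>j\<close> with \<open>j < n\<close> and hence orthogonal to \<open>P'\<^sub>n\<close>.\<close>

lemma orthogonal_sequences_proportional:
  fixes P P' :: "nat \<Rightarrow> real poly"
  assumes deg: "\<And>i. degree (P i) = i" and orth: "\<And>i j. i \<noteq> j \<Longrightarrow> L (P i * P j) = 0"
    and pos: "\<And>i. L (P i * P i) \<noteq> 0"
    and deg': "\<And>i. degree (P' i) = i" and orth': "\<And>i j. i \<noteq> j \<Longrightarrow> L (P' i * P' j) = 0"
    and pos': "\<And>i. L (P' i * P' i) \<noteq> 0"
  shows "\<exists>s. P' n = smult s (P n)"
proof -
  have "P' 0 \<noteq> 0" "P 0 \<noteq> 0" using pos[of 0] pos'[of 0] by auto
  obtain c where c: "P' n = (\<Sum>i<Suc n. smult (c i) (P i))"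
    using graded_basis[of P "P' n" "Suc n"] deg deg' \<open>P 0 \<noteq> 0\<close> by auto
  have "c i = 0" if i: "i < n" for i
  proof -
    obtain d where d: "P i = (\<Sum>j<n. smult (d j) (P' j))"
      using graded_basis[of P' "P i" n] deg deg' i \<open>P' 0 \<noteq> 0\<close> by auto
    have "L (P i * P' n) = 0"
      unfolding d sum_distrib_right sum by (auto intro!: sum.neutral simp: smult orth')
    moreover have "L (P i * P' n) = (\<Sum>j<Suc n. if j = i then c i * L (P i * P i) else 0)"
      unfolding c sum_distrib_left sum by (rule sum.cong) (auto simp: smult orth)
    moreover have "\<dots> = c i * L (P i * P i)"
      using i by (simp only: sum.delta finite_lessThan) simp
    ultimately show ?thesis using pos by simp
  qed
  then have "P' n = smult (c n) (P n)"
    using c by simp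
  then show ?thesis ..
qed

end

section \<open>A sine integral against a Poisson-type denominator\<close>

text \<open>The denominator is \<open>\<bar>1 + r exp (\<i> \<theta>)\<bar>\<^sup>2\<close>. The lower bound is uniform in the angle, which yields
  the boundedness of the integrals below.\<close>

lemma poisson_denominator_ge:
  fixes r :: real
  shows "1 + r\<^sup>2 + 2 * r * cos \<theta> \<ge> (1 - \<bar>r\<bar>)\<^sup>2"
proof -
  have "\<bar>r * cos \<theta>\<bar> \<le> \<bar>r\<bar>"
    using abs_cos_le_one[of \<theta>] by (simp add: abs_mult mult_left_le)
  then show ?thesis
    by (simp add: power2_eq_square algebra_simps)
qed

lemma poisson_denominator_pos:
  fixes r :: real
  assumes "\<bar>r\<bar> < 1"
  shows "1 + r\<^sup>2 + 2 * r * cos \<theta> > 0"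
proof -
  have "(1 - \<bar>r\<bar>)\<^sup>2 > 0" using assms by simp
  then show ?thesis using poisson_denominator_ge[of r \<theta>] by linarith
qed

text \<open>This is \<open>sin\<^sup>2 \<theta> (U\<^sub>n + r U\<^sub>n\<^sub>-\<^sub>1) / \<bar>1 + r exp (\<i> \<theta>)\<bar>\<^sup>2\<close> with the Chebyshev polynomials \<open>U\<close> of the second kind
  evaluated at \<open>cos \<theta>\<close>, using \<open>sin \<theta> U\<^sub>n (cos \<theta>) = sin ((n + 1) \<theta>)\<close>.\<close>

definition poisson_sine :: "real \<Rightarrow> nat \<Rightarrow> real \<Rightarrow> real" where
  "poisson_sine r n \<theta> =
     sin \<theta> * (sin (real (n + 1) * \<theta>) + r * sin (real n * \<theta>)) / (1 + r\<^sup>2 + 2 * r * cos \<theta>)"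

definition poisson_sine_integral :: "real \<Rightarrow> nat \<Rightarrow> real" where
  "poisson_sine_integral r n = integral {0..pi} (poisson_sine r n)"

lemma continuous_on_poisson_sine:
  assumes "\<bar>r\<bar> < 1"
  shows "continuous_on A (poisson_sine r n)"
  unfolding poisson_sine_def using poisson_denominator_pos[OF assms]
  by (intro continuous_intros ballI) (metis less_irrefl)

lemma sin_multiple_add:
  "sin (real (n + 2) * \<theta>) + sin (real n * \<theta>) = 2 * cos \<theta> * sin (real (n + 1) * \<theta>)"
proof -
  have "real (n + 2) * \<theta> = real (n + 1) * \<theta> + \<theta>" "real n * \<theta> = real (n + 1) * \<theta> - \<theta>"
    by (auto simp: algebra_simps)
  then show ?thesis by (simp add: sin_add sin_diff)
qed

lemma has_integral_cos_multiple:
  assumes "n > 0"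
  shows "((\<lambda>\<theta>. cos (real n * \<theta>)) has_integral 0) {0..pi}"
proof -
  have "((\<lambda>\<theta>. cos (real n * \<theta>)) has_integral
      (sin (real n * pi) / real n - sin (real n * 0) / real n)) {0..pi}"
    by (rule fundamental_theorem_of_calculus)
      (use assms in \<open>auto intro!: derivative_eq_intros simp flip: has_real_derivative_iff_has_vector_derivative\<close>)
  then show ?thesis by simp
qed

lemma has_integral_sin_times_sin_multiple:
  "((\<lambda>\<theta>. sin \<theta> * sin (real (n + 1) * \<theta>)) has_integral (if n = 0 then pi / 2 else 0)) {0..pi}"
proof -
  have "((\<lambda>\<theta>. cos (real n * \<theta>)) has_integral (if n = 0 then pi else 0)) {0..pi}"
    using has_integral_cos_multiple[of n] has_integral_const_real[of "1::real" 0 pi] by (cases n) auto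
  then have "((\<lambda>\<theta>. (cos (real n * \<theta>) - cos (real (n + 2) * \<theta>)) / 2)
      has_integral ((if n = 0 then pi else 0) - 0) / 2) {0..pi}"
    by (intro has_integral_divide has_integral_diff has_integral_cos_multiple) auto
  moreover have "(cos (real n * \<theta>) - cos (real (n + 2) * \<theta>)) / 2 = sin \<theta> * sin (real (n + 1) * \<theta>)" for \<theta>
  proof -
    have "\<theta> - real (n + 1) * \<theta> = - (real n * \<theta>)" "\<theta> + real (n + 1) * \<theta> = real (n + 2) * \<theta>"
      by (simp_all add: algebra_simps)
    then show ?thesis by (simp only: sin_times_sin cos_minus)
  qed
  moreover have "((if n = 0 then pi else 0) - 0) / 2 = (if n = 0 then pi / 2 else 0)"
    by simp
  ultimately show ?thesis by (simp only:)
qed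

text \<open>In \<open>r (sin ((n + 2) \<theta>) + r sin ((n + 1) \<theta>)) + (sin ((n + 1) \<theta>) + r sin (n \<theta>))\<close> the outer terms combine to
  \<open>2 r cos \<theta> sin ((n + 1) \<theta>)\<close>, so the whole is the denominator times \<open>sin ((n + 1) \<theta>)\<close>. The denominator
  cancels and the orthogonality of the sines remains.\<close>

lemma poisson_sine_integral_rec:
  assumes "\<bar>r\<bar> < 1"
  shows "r * poisson_sine_integral r (Suc n) + poisson_sine_integral r n = (if n = 0 then pi / 2 else 0)"
proof (rule has_integral_unique)
  have "r * poisson_sine r (Suc n) \<theta> + poisson_sine r n \<theta> = sin \<theta> * sin (real (n + 1) * \<theta>)" for \<theta>
  proof -
    let ?D = "1 + r\<^sup>2 + 2 * r * cos \<theta>"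
    have "r * (sin (real (n + 2) * \<theta>) + r * sin (real (n + 1) * \<theta>))
        + (sin (real (n + 1) * \<theta>) + r * sin (real n * \<theta>)) = ?D * sin (real (n + 1) * \<theta>)"
      using sin_multiple_add[of n \<theta>] by algebra
    moreover have "r * poisson_sine r (Suc n) \<theta> + poisson_sine r n \<theta> = sin \<theta> *
      (r * (sin (real (n + 2) * \<theta>) + r * sin (real (n + 1) * \<theta>))
        + (sin (real (n + 1) * \<theta>) + r * sin (real n * \<theta>))) / ?D"
      by (simp add: poisson_sine_def add_divide_distrib algebra_simps)
    ultimately show ?thesis
      using poisson_denominator_pos[OF assms, of \<theta>] by simp
  qed
  moreover have "((\<lambda>\<theta>. r * poisson_sine r (Suc n) \<theta> + poisson_sine r n \<theta>) has_integral
      r * poisson_sine_integral r (Suc n) + poisson_sine_integral r n) {0..pi}"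
    unfolding poisson_sine_integral_def
    by (intro has_integral_add has_integral_mult_right integrable_integral
        integrable_continuous_real continuous_on_poisson_sine assms)
  ultimately show "((\<lambda>\<theta>. sin \<theta> * sin (real (n + 1) * \<theta>)) has_integral
      r * poisson_sine_integral r (Suc n) + poisson_sine_integral r n) {0..pi}"
    by simp
qed (rule has_integral_sin_times_sin_multiple)

lemma poisson_sine_integral_bounded:
  assumes "\<bar>r\<bar> < 1"
  shows "\<bar>poisson_sine_integral r n\<bar> \<le> 2 / (1 - \<bar>r\<bar>)\<^sup>2 * pi"
proof -
  have "norm (integral {0..pi} (poisson_sine r n)) \<le> 2 / (1 - \<bar>r\<bar>)\<^sup>2 * (pi - 0)"
  proof (rule integral_bound)
    fix \<theta> :: real
    let ?D = "1 + r\<^sup>2 + 2 * r * cos \<theta>"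
    have "\<bar>r * sin (real n * \<theta>)\<bar> \<le> 1 * 1"
      unfolding abs_mult using assms by (intro mult_mono) auto
    then have "\<bar>sin (real (n + 1) * \<theta>) + r * sin (real n * \<theta>)\<bar> \<le> 2"
      using abs_sin_le_one[of "real (n + 1) * \<theta>"] by linarith
    then have "\<bar>sin \<theta> * (sin (real (n + 1) * \<theta>) + r * sin (real n * \<theta>))\<bar> \<le> 1 * 2"
      unfolding abs_mult by (intro mult_mono) auto
    moreover have "(1 - \<bar>r\<bar>)\<^sup>2 > 0" using assms by simp
    ultimately show "norm (poisson_sine r n \<theta>) \<le> 2 / (1 - \<bar>r\<bar>)\<^sup>2"
      using poisson_denominator_ge[of r \<theta>] poisson_denominator_pos[OF assms, of \<theta>]
      unfolding real_norm_def abs_divide poisson_sine_def by (intro frac_le) auto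
  qed (simp_all add: continuous_on_poisson_sine assms)
  then show ?thesis
    by (simp add: poisson_sine_integral_def)
qed

text \<open>For positive indices the recurrence is homogeneous, and its solutions are multiples of \<open>(- 1 / r)\<^sup>n\<close>.
  Iterating it towards large indices instead of dividing by \<open>r\<close> also covers \<open>r = 0\<close>.\<close>

lemma poisson_sine_integral_Suc:
  assumes "\<bar>r\<bar> < 1"
  shows "poisson_sine_integral r (Suc n) = 0"
proof -
  let ?E = "poisson_sine_integral r"
  have iter: "?E (Suc n) = (- r) ^ m * ?E (Suc n + m)" for m
  proof (induction m)
    case (Suc m)
    have "?E (Suc n + m) = - r * ?E (Suc n + Suc m)"
      using poisson_sine_integral_rec[OF assms, of "Suc n + m"] by simp
    then show ?case using Suc by simp
  qed simp
  have "(\<lambda>m. (- r) ^ m * ?E (Suc n + m)) \<longlonglongrightarrow> 0"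
  proof (rule Lim_null_comparison)
    show "\<forall>\<^sub>F m in sequentially. norm ((- r) ^ m * ?E (Suc n + m))
        \<le> \<bar>r\<bar> ^ m * (2 / (1 - \<bar>r\<bar>)\<^sup>2 * pi)"
      unfolding real_norm_def abs_mult power_abs abs_minus_cancel
      by (intro always_eventually allI mult_left_mono poisson_sine_integral_bounded assms) simp
    show "(\<lambda>m. \<bar>r\<bar> ^ m * (2 / (1 - \<bar>r\<bar>)\<^sup>2 * pi)) \<longlonglongrightarrow> 0"
      using assms by (intro tendsto_mult_left_zero LIMSEQ_power_zero) auto
  qed
  then have "(\<lambda>m. ?E (Suc n)) \<longlonglongrightarrow> 0"
    by (simp only: iter[symmetric])
  then show ?thesis
    by (simp add: LIMSEQ_const_iff)
qed

lemma poisson_sine_integral_0: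
  assumes "\<bar>r\<bar> < 1"
  shows "poisson_sine_integral r 0 = pi / 2"
  using poisson_sine_integral_rec[OF assms, of 0] poisson_sine_integral_Suc[OF assms] by simp

section \<open>The recurrence coefficients\<close>

text \<open>The upper bound 2 is preserved by the recursion because \<open>(k - 1) / k\<^sup>2 < 1 / 4\<close>, which is
  \<open>(k - 2)\<^sup>2 > 0\<close>.\<close>

lemma delta_bounds:
  assumes "k \<ge> 3"
  shows "0 < delta k t" "delta k t < 2"
proof -
  have k: "real k \<ge> 3" using assms by simp
  have "0 < (real k - 2) * (real k - 2)" using k by simp
  then have q: "0 < (real k - 1) / (real k)\<^sup>2" "(real k - 1) / (real k)\<^sup>2 < 1 / 4"
    using k by (simp_all add: divide_less_eq power2_eq_square algebra_simps)
  have "0 < delta k t \<and> delta k t < 2"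
  proof (induction t)
    case 0
    show ?case using k by (simp add: divide_less_eq)
  next
    case (Suc t)
    then have "(real k - 1) / (real k)\<^sup>2 * delta k t < 1 / 4 * 2"
      using q by (intro mult_strict_mono) auto
    then have "1 / 2 < 1 - (real k - 1) / (real k)\<^sup>2 * delta k t"
      by linarith
    moreover have "0 < inverse z \<and> inverse z < 2" if "1 / 2 < z" for z :: real
      using less_imp_inverse_less[OF that] that by simp
    ultimately show ?case
      unfolding delta.simps by blast
  qed
  then show "0 < delta k t" "delta k t < 2" by auto
qed

text \<open>This makes the coefficient \<open>1 - \<delta>\<^sub>t\<close> of the recurrence negative, as the positivity of the norms
  requires.\<close>

lemma delta_Suc_gt_1:
  assumes "k \<ge> 3"
  shows "delta k (Suc t) > 1"
proof -
  define y where "y = (real k - 1) / (real k)\<^sup>2 * delta k t"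
  have d: "delta k (Suc t) = inverse (1 - y)"
    by (simp add: y_def)
  have "y > 0"
    unfolding y_def using delta_bounds(1)[OF assms, of t] assms by (intro mult_pos_pos divide_pos_pos) auto
  moreover have "1 - y > 0"
    using delta_bounds(1)[OF assms, of "Suc t"] unfolding d by simp
  ultimately show ?thesis
    unfolding d by (intro one_less_inverse) auto
qed

lemma delta_Suc_eq:
  assumes "k \<ge> 3"
  shows "1 - delta k (Suc t) = - ((real k - 1) / (real k)\<^sup>2) * delta k t * delta k (Suc t)"
proof -
  define y where "y = (real k - 1) / (real k)\<^sup>2 * delta k t"
  have d: "delta k (Suc t) = inverse (1 - y)"
    by (simp add: y_def)
  have "1 - y \<noteq> 0"
    using delta_bounds(1)[OF assms, of "Suc t"] unfolding d by auto
  then have "1 - inverse (1 - y) = - y * inverse (1 - y)"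
    by (simp add: field_simps)
  then show ?thesis unfolding d y_def by simp
qed

lemma poly_Q_0 [simp]: "poly (Q k n) 0 = 1"
  by (induction k n rule: Q.induct) (simp_all del: delta.simps)


section \<open>Trigonometric form of the polynomials\<close>

text \<open>Half the length of the support interval, whose midpoint is 1.\<close>

definition support_radius :: "nat \<Rightarrow> real" where
  "support_radius k = 2 * sqrt (real k - 1) / real k"

text \<open>The root \<open>r\<close> in \<open>(0, 1)\<close> of \<open>c (1 + r\<^sup>2) = 2 r\<close>, where \<open>c\<close> is the support radius; it turns \<open>1 + c cos \<theta>\<close>
  into a multiple of \<open>1 + r\<^sup>2 + 2 r cos \<theta>\<close>.\<close>

definition poisson_radius :: "nat \<Rightarrow> real" where
  "poisson_radius k = 1 / sqrt (real k - 1)"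

lemma radii:
  assumes "k \<ge> 3"
  shows "0 < support_radius k" "support_radius k < 1"
    "(support_radius k)\<^sup>2 = 4 * (real k - 1) / (real k)\<^sup>2"
    "0 < poisson_radius k" "poisson_radius k < 1"
    "(poisson_radius k)\<^sup>2 = 1 / (real k - 1)"
    "support_radius k * (1 + (poisson_radius k)\<^sup>2) = 2 * poisson_radius k"
    "real k * support_radius k * poisson_radius k = 2"
proof -
  have k: "real k \<ge> 3" using assms by simp
  show "0 < support_radius k" and c2: "(support_radius k)\<^sup>2 = 4 * (real k - 1) / (real k)\<^sup>2"
    and "0 < poisson_radius k" "poisson_radius k < 1"
    and r2: "(poisson_radius k)\<^sup>2 = 1 / (real k - 1)"
    using k by (auto simp: support_radius_def poisson_radius_def power_divide power_mult_distrib)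
  \<comment> \<open>the radius is below 1 because \<open>k\<^sup>2 - 4 (k - 1) = (k - 2)\<^sup>2\<close>\<close>
  have "(real k - 2)\<^sup>2 > 0" using assms by simp
  then have "(support_radius k)\<^sup>2 < 1\<^sup>2"
    unfolding c2 using k by (simp add: field_simps power2_eq_square)
  then show "support_radius k < 1"
    using power2_less_imp_less[of "support_radius k" 1] by simp
  have s: "sqrt (real k - 1) * sqrt (real k - 1) = real k - 1" "sqrt (real k - 1) > 0"
    using k by auto
  have "2 * sqrt (real k - 1) / real k * (1 + 1 / (real k - 1)) = 2 * sqrt (real k - 1) / (real k - 1)"
    using k by (simp add: field_simps)
  also have "\<dots> = 2 * (1 / sqrt (real k - 1))"
    using s k by (simp add: field_simps)
  finally show "support_radius k * (1 + (poisson_radius k)\<^sup>2) = 2 * poisson_radius k"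
    by (simp add: r2) (simp add: support_radius_def poisson_radius_def)
  show "real k * support_radius k * poisson_radius k = 2"
    using k s(2) by (simp add: support_radius_def poisson_radius_def)
qed

text \<open>The functions \<open>S\<^sub>n = sin ((n + 1) \<theta>) + r sin (n \<theta>)\<close> satisfy \<open>S\<^sub>n\<^sub>+\<^sub>1 = 2 cos \<theta> S\<^sub>n - S\<^sub>n\<^sub>-\<^sub>1\<close>. Scaling them by the product
  of the \<open>(c / 2) \<delta>\<^sub>t\<close> turns this into the recurrence of the polynomials, because
  \<open>1 - \<delta>\<^sub>t = - (c / 2)\<^sup>2 \<delta>\<^sub>t\<^sub>-\<^sub>1 \<delta>\<^sub>t\<close> is a reformulation of the recursion for \<open>\<delta>\<close>. The special value of
  \<open>\<delta>\<^sub>0\<close> accounts for the initial polynomial of degree 1.\<close>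

lemma Q_trigonometric:
  fixes k :: nat
  assumes k: "k \<ge> 3"
  defines "c \<equiv> support_radius k" and "r \<equiv> poisson_radius k"
  shows "sin \<theta> * poly (Q k n) (1 - c * cos \<theta>) =
    (\<Prod>t<n. c / 2 * delta k t) * (sin (real (n + 1) * \<theta>) + r * sin (real n * \<theta>))"
proof (induction n rule: less_induct)
  case (less n)
  consider "n = 0" | "n = 1" | m where "n = m + 2"
    by (metis One_nat_def add_2_eq_Suc' not0_implies_Suc)
  then show ?case
  proof cases
    case 2
    have "r * c = 2 / real k"
      using radii(8)[OF k] k by (simp add: c_def r_def field_simps)
    then have *: "c / 2 * delta k 0 * r = 1 - delta k 0"
      using k by (simp add: field_simps)
    have "sin \<theta> * (1 - delta k 0 * (1 - c * cos \<theta>))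
      = (1 - delta k 0) * sin \<theta> + c / 2 * delta k 0 * (2 * sin \<theta> * cos \<theta>)"
      by algebra
    also have "\<dots> = c / 2 * delta k 0 * (sin (2 * \<theta>) + r * sin \<theta>)"
      unfolding sin_double using * by algebra
    finally show ?thesis
      using 2 by (simp add: mult.commute)
  next
    case 3
    let ?S = "\<lambda>j. sin (real (j + 1) * \<theta>) + r * sin (real j * \<theta>)"
    have S: "?S (m + 2) + ?S m = 2 * cos \<theta> * ?S (m + 1)"
    proof -
      have "m + 1 + 2 = m + 2 + 1" "m + 1 + 1 = m + 2" by simp_all
      with sin_multiple_add[of "m + 1" \<theta>]
      have "sin (real (m + 2 + 1) * \<theta>) + sin (real (m + 1) * \<theta>) = 2 * cos \<theta> * sin (real (m + 2) * \<theta>)"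
        by (simp only:)
      with sin_multiple_add[of m \<theta>] show ?thesis
        by (simp only: \<open>m + 1 + 1 = m + 2\<close>) algebra
    qed
    define p where "p = (\<Prod>t<m. c / 2 * delta k t)"
    define x where "x = 1 - c * cos \<theta>"
    have IH: "sin \<theta> * poly (Q k (m + 1)) x = p * (c / 2 * delta k m) * ?S (m + 1)"
      "sin \<theta> * poly (Q k m) x = p * ?S m"
      using less[of "m + 1"] less[of m] 3 by (auto simp: p_def x_def)
    have d: "1 - delta k (m + 1) = - (c / 2)\<^sup>2 * delta k m * delta k (m + 1)"
    proof -
      have "4 * u / v / 2\<^sup>2 = u / v" for u v :: real by simp
      then have "(c / 2)\<^sup>2 = (real k - 1) / (real k)\<^sup>2"
        unfolding c_def power_divide radii(3)[OF k] by blast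
      then show ?thesis
        using delta_Suc_eq[OF k, of m] by (simp only: Suc_eq_plus1)
    qed
    have "sin \<theta> * poly (Q k (m + 2)) x
      = delta k (m + 1) * (1 - x) * (sin \<theta> * poly (Q k (m + 1)) x)
        + (1 - delta k (m + 1)) * (sin \<theta> * poly (Q k m) x)"
      by (simp add: algebra_simps del: delta.simps)
    also have "\<dots> = p * (c / 2 * delta k m) * (c / 2 * delta k (m + 1)) * (2 * cos \<theta> * ?S (m + 1) - ?S m)"
      unfolding IH d unfolding x_def by (simp add: algebra_simps power2_eq_square del: delta.simps)
    also have "2 * cos \<theta> * ?S (m + 1) - ?S m = ?S (m + 2)"
      using S by linarith
    finally show ?thesis
      using 3 by (simp add: p_def x_def mult.assoc del: delta.simps)
  qed simp
qed


section \<open>The measures in the angle variable\<close>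

lemma cosine_substitution:
  fixes c :: real and f :: "real \<Rightarrow> real"
  assumes "c \<ge> 0" "continuous_on {1 - c..1 + c} f"
  shows "((\<lambda>\<theta>. c * sin \<theta> * f (1 - c * cos \<theta>)) has_integral integral {1 - c..1 + c} f) {0..pi}"
proof -
  have "\<bar>c * cos \<theta>\<bar> \<le> c" for \<theta>
    using assms(1) by (simp add: abs_mult mult_left_le)
  then have "1 - c * cos \<theta> \<in> {1 - c..1 + c}" for \<theta>
    using abs_le_D1[of "c * cos \<theta>" c] abs_le_D2[of "c * cos \<theta>" c] by simp
  then have "(\<lambda>\<theta>. 1 - c * cos \<theta>) ` {0..pi} \<subseteq> {1 - c..1 + c}"
    by blast
  moreover have "((\<lambda>\<theta>. 1 - c * cos \<theta>) has_field_derivative c * sin \<theta>) (at \<theta> within {0..pi})" for \<theta>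
    by (auto intro!: derivative_eq_intros)
  ultimately show ?thesis
    using has_integral_substitution[of 0 pi "\<lambda>\<theta>. 1 - c * cos \<theta>" "1 - c" "1 + c" f "\<lambda>\<theta>. c * sin \<theta>"] assms
    by simp
qed

text \<open>This passes from the abstract density to an integral over an interval, where substitution and the
  fundamental theorem of calculus apply.\<close>

lemma density_Icc_integral:
  fixes h f :: "real \<Rightarrow> real"
  assumes h: "continuous_on {a..b} h" "\<And>x. x \<in> {a..b} \<Longrightarrow> h x \<ge> 0"
    and f: "continuous_on UNIV f"
    and M: "M = density lborel (\<lambda>x. ennreal (indicator {a..b} x * h x))"
  shows "integrable M f" "(\<integral>x. f x \<partial>M) = integral {a..b} (\<lambda>x. h x * f x)"
proof -
  have meas [measurable]: "(\<lambda>x. indicator {a..b} x * h x) \<in> borel_measurable borel"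
    using borel_measurable_continuous_on_indicator[OF _ h(1)] by simp
  have nn: "AE x in lborel. 0 \<le> indicator {a..b} x * h x"
    using h(2) by (auto simp: indicator_def)
  have [measurable]: "f \<in> borel_measurable borel"
    using f by (rule borel_measurable_continuous_onI)
  have int: "set_integrable lborel {a..b} (\<lambda>x. h x * f x)"
    by (intro borel_integrable_atLeastAtMost' continuous_intros h continuous_on_subset[OF f]) auto
  show "integrable M f"
    unfolding M using int nn by (subst integrable_density) (auto simp: set_integrable_def mult.assoc)
  have "(\<integral>x. f x \<partial>M) = (LINT x:{a..b}|lborel. h x * f x)"
    unfolding M using nn by (subst integral_density) (auto simp: set_lebesgue_integral_def mult.assoc)
  also have "\<dots> = integral {a..b} (\<lambda>x. h x * f x)"
    using int by (rule set_borel_integral_eq_integral)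
  finally show "(\<integral>x. f x \<partial>M) = integral {a..b} (\<lambda>x. h x * f x)" .
qed

lemma spectral_interval_bounds:
  assumes "k \<ge> 3" "x \<in> {1 - support_radius k..1 + support_radius k}"
  shows "0 < x" "x < 2" "(1 - x)\<^sup>2 \<le> (support_radius k)\<^sup>2" "(1 - x)\<^sup>2 < 1"
proof -
  have b: "0 < support_radius k" "support_radius k < 1"
    using radii assms(1) by auto
  then show "0 < x" "x < 2" using assms(2) by auto
  have "\<bar>1 - x\<bar> \<le> support_radius k" using assms(2) by auto
  then show *: "(1 - x)\<^sup>2 \<le> (support_radius k)\<^sup>2"
    using b by (metis abs_le_square_iff abs_of_pos)
  have "(support_radius k)\<^sup>2 < 1"
    using b by (simp add: power_less_one_iff)
  then show "(1 - x)\<^sup>2 < 1" using * by linarith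
qed

lemma spectral_measure_eq:
  assumes "k \<ge> 3"
  defines "c \<equiv> support_radius k"
  shows "spectral_measure k = density lborel (\<lambda>x. ennreal (indicator {1 - c..1 + c} x *
    (real k / (2 * pi) * (sqrt (c\<^sup>2 - (1 - x)\<^sup>2) / (1 - (1 - x)\<^sup>2)))))"
  unfolding spectral_measure_def c_def radii(3)[OF assms(1)] unfolding support_radius_def ..

text \<open>As \<open>1 - (1 - x)\<^sup>2 = x (2 - x)\<close>, the weight cancels a factor of the denominator.\<close>

lemma weighted_spectral_measure_eq:
  assumes k: "k \<ge> 3"
  defines "c \<equiv> support_radius k"
  shows "weighted_spectral_measure k = density lborel (\<lambda>x. ennreal (indicator {1 - c..1 + c} x *
    (real k / (2 * pi) * (sqrt (c\<^sup>2 - (1 - x)\<^sup>2) / (2 - x)))))"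
proof -
  define w where "w = (\<lambda>x. indicator {1 - c..1 + c} x *
    (real k / (2 * pi) * (sqrt (c\<^sup>2 - (1 - x)\<^sup>2) / (1 - (1 - x)\<^sup>2))))"
  have [measurable]: "w \<in> borel_measurable borel"
    unfolding w_def by measurable
  have "weighted_spectral_measure k = density lborel (\<lambda>x. ennreal (w x) * ennreal x)"
    unfolding weighted_spectral_measure_def spectral_measure_eq[OF k]
    by (subst density_density_eq) (auto simp: w_def c_def)
  also have "(\<lambda>x. ennreal (w x) * ennreal x) = (\<lambda>x. ennreal (indicator {1 - c..1 + c} x *
      (real k / (2 * pi) * (sqrt (c\<^sup>2 - (1 - x)\<^sup>2) / (2 - x)))))"
  proof
    fix x :: real
    show "ennreal (w x) * ennreal x = ennreal (indicator {1 - c..1 + c} x *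
      (real k / (2 * pi) * (sqrt (c\<^sup>2 - (1 - x)\<^sup>2) / (2 - x))))"
    proof (cases "x \<in> {1 - c..1 + c}")
      case True
      have x: "0 < x" "x < 2"
        using spectral_interval_bounds[OF k, of x] True by (auto simp: c_def)
      have "1 - (1 - x)\<^sup>2 = (2 - x) * x"
        by (simp add: power2_eq_square algebra_simps)
      then have "w x * x = real k / (2 * pi) * (sqrt (c\<^sup>2 - (1 - x)\<^sup>2) / (2 - x))"
        using x True by (simp add: w_def)
      then show ?thesis
        using x True by (simp flip: ennreal_mult'')
    qed (simp add: w_def)
  qed
  finally show ?thesis .
qed

lemma sqrt_cosine_substitution:
  assumes "c \<ge> 0" "\<theta> \<in> {0..pi}"
  shows "sqrt (c\<^sup>2 - (c * cos \<theta>)\<^sup>2) = c * sin \<theta>"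
proof -
  have "c\<^sup>2 - (c * cos \<theta>)\<^sup>2 = (c * sin \<theta>)\<^sup>2"
    unfolding power_mult_distrib sin_squared_eq by (simp add: algebra_simps)
  then show ?thesis
    using assms sin_ge_zero[of \<theta>] by simp
qed

text \<open>The identity behind it is \<open>(1 + r\<^sup>2) (1 + c cos \<theta>) = 1 + r\<^sup>2 + 2 r cos \<theta>\<close>. The sign \<open>s\<close> is there for the
  unweighted measure, whose density has both factors \<open>1 + c cos \<theta>\<close> and \<open>1 - c cos \<theta>\<close> in the denominator.\<close>

lemma poisson_denominator_spectral:
  fixes k :: nat and s \<theta> :: real
  assumes k: "k \<ge> 3" and s: "s = 1 \<or> s = -1"
  defines "c \<equiv> support_radius k" and "r \<equiv> poisson_radius k"
  shows "real k * c\<^sup>2 / (1 + s * c * cos \<theta>) = 4 / (1 + (s * r)\<^sup>2 + 2 * (s * r) * cos \<theta>)"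
proof -
  have sr: "\<bar>s * r\<bar> < 1" "(s * r)\<^sup>2 = r\<^sup>2"
    using s radii(4,5)[OF k] by (auto simp: r_def)
  have D: "1 + (s * r)\<^sup>2 + 2 * (s * r) * cos \<theta> = (1 + r\<^sup>2) * (1 + s * c * cos \<theta>)"
    unfolding sr(2) using radii(7)[OF k] unfolding c_def r_def by algebra
  have "real k * c\<^sup>2 * (1 + r\<^sup>2) = 4"
    using radii(7,8)[OF k] unfolding c_def r_def by algebra
  moreover have "1 + r\<^sup>2 > 0" by (simp add: add_pos_nonneg)
  ultimately have "4 / ((1 + r\<^sup>2) * (1 + s * c * cos \<theta>)) = (1 + r\<^sup>2) * (real k * c\<^sup>2) / ((1 + r\<^sup>2) * (1 + s * c * cos \<theta>))"
    by (simp add: mult.commute)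
  also have "\<dots> = real k * c\<^sup>2 / (1 + s * c * cos \<theta>)"
    using \<open>1 + r\<^sup>2 > 0\<close> by (intro mult_divide_mult_cancel_left) simp
  finally show ?thesis unfolding D ..
qed

lemma weighted_spectral_measure_integral:
  fixes k :: nat and f :: "real \<Rightarrow> real"
  assumes k: "k \<ge> 3" and f: "continuous_on UNIV f"
  defines "c \<equiv> support_radius k" and "r \<equiv> poisson_radius k"
  shows "integrable (weighted_spectral_measure k) f"
    and "((\<lambda>\<theta>. 2 / pi * (sin \<theta> * (sin \<theta> * f (1 - c * cos \<theta>)) / (1 + r\<^sup>2 + 2 * r * cos \<theta>)))
      has_integral (\<integral>x. f x \<partial>weighted_spectral_measure k)) {0..pi}"
proof -
  define h where "h = (\<lambda>x. real k / (2 * pi) * (sqrt (c\<^sup>2 - (1 - x)\<^sup>2) / (2 - x)))"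
  have c: "c > 0" using radii(1)[OF k] by (simp add: c_def)
  note b = spectral_interval_bounds[OF k, folded c_def]
  have h: "continuous_on {1 - c..1 + c} h"
    unfolding h_def using b(2) by (intro continuous_intros) fastforce+
  have nn: "h x \<ge> 0" if "x \<in> {1 - c..1 + c}" for x
    unfolding h_def using b(2,3)[OF that] by (intro mult_nonneg_nonneg divide_nonneg_nonneg) auto
  have M: "weighted_spectral_measure k = density lborel (\<lambda>x. ennreal (indicator {1 - c..1 + c} x * h x))"
    using weighted_spectral_measure_eq[OF k] by (simp add: h_def c_def)
  note * = density_Icc_integral[OF h nn f M]
  show "integrable (weighted_spectral_measure k) f"
    by (rule *(1))
  have "((\<lambda>\<theta>. c * sin \<theta> * (h (1 - c * cos \<theta>) * f (1 - c * cos \<theta>)))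
      has_integral (\<integral>x. f x \<partial>weighted_spectral_measure k)) {0..pi}"
    using cosine_substitution[of c "\<lambda>x. h x * f x"] c h continuous_on_subset[OF f subset_UNIV] *(2)
    by (simp add: continuous_on_mult)
  then show "((\<lambda>\<theta>. 2 / pi * (sin \<theta> * (sin \<theta> * f (1 - c * cos \<theta>)) / (1 + r\<^sup>2 + 2 * r * cos \<theta>)))
      has_integral (\<integral>x. f x \<partial>weighted_spectral_measure k)) {0..pi}"
  proof (rule has_integral_eq[rotated])
    fix \<theta> assume \<theta>: "\<theta> \<in> {0..pi}"
    have "c * sin \<theta> * (h (1 - c * cos \<theta>) * f (1 - c * cos \<theta>))
      = real k * c\<^sup>2 / (1 + 1 * c * cos \<theta>) * (sin \<theta> * sin \<theta> * f (1 - c * cos \<theta>)) / (2 * pi)"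
      using sqrt_cosine_substitution[of c \<theta>] c \<theta> by (simp add: h_def power2_eq_square mult_ac)
    also have "\<dots> = 2 / pi * (sin \<theta> * (sin \<theta> * f (1 - c * cos \<theta>)) / (1 + r\<^sup>2 + 2 * r * cos \<theta>))"
      unfolding c_def by (subst poisson_denominator_spectral[OF k]) (simp_all add: r_def)
    finally show "c * sin \<theta> * (h (1 - c * cos \<theta>) * f (1 - c * cos \<theta>))
      = 2 / pi * (sin \<theta> * (sin \<theta> * f (1 - c * cos \<theta>)) / (1 + r\<^sup>2 + 2 * r * cos \<theta>))" .
  qed
qed

lemma integral_Q:
  assumes k: "k \<ge> 3"
  shows "(\<integral>x. poly (Q k n) x \<partial>weighted_spectral_measure k) = (if n = 0 then 1 else 0)"
proof -
  define c r where "c = support_radius k" and "r = poisson_radius k"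
  define A where "A = (\<Prod>t<n. c / 2 * delta k t)"
  have r: "\<bar>r\<bar> < 1" using radii(4,5)[OF k] by (simp add: r_def)
  have "((\<lambda>\<theta>. 2 / pi * (A * poisson_sine r n \<theta>)) has_integral
      (\<integral>x. poly (Q k n) x \<partial>weighted_spectral_measure k)) {0..pi}"
    using weighted_spectral_measure_integral(2)[OF k, of "poly (Q k n)"]
    unfolding Q_trigonometric[OF k]
    by (simp add: poisson_sine_def A_def c_def r_def continuous_on_poly algebra_simps)
  moreover have "((\<lambda>\<theta>. 2 / pi * (A * poisson_sine r n \<theta>)) has_integral
      2 / pi * (A * poisson_sine_integral r n)) {0..pi}"
    unfolding poisson_sine_integral_def
    by (intro has_integral_mult_right integrable_integral integrable_continuous_real
        continuous_on_poisson_sine r)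
  ultimately have "(\<integral>x. poly (Q k n) x \<partial>weighted_spectral_measure k) = 2 / pi * (A * poisson_sine_integral r n)"
    by (rule has_integral_unique)
  then show ?thesis
    using poisson_sine_integral_0[OF r] poisson_sine_integral_Suc[OF r] by (cases n) (auto simp: A_def)
qed

text \<open>The denominator is now \<open>1 - c\<^sup>2 cos\<^sup>2 \<theta>\<close>. Its partial fractions give one half of the weighted
  integral with parameter \<open>r\<close> and one half of that with parameter \<open>- r\<close>.\<close>

lemma prob_space_spectral_measure:
  assumes k: "k \<ge> 3"
  shows "prob_space (spectral_measure k)"
proof
  define c r where "c = support_radius k" and "r = poisson_radius k"
  have r: "\<bar>r\<bar> < 1" "\<bar>- r\<bar> < 1" using radii(4,5)[OF k] by (simp_all add: r_def)
  have c: "0 < c" "c < 1" using radii(1,2)[OF k] by (simp_all add: c_def)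
  let ?M = "spectral_measure k"
  define h where "h = (\<lambda>x. real k / (2 * pi) * (sqrt (c\<^sup>2 - (1 - x)\<^sup>2) / (1 - (1 - x)\<^sup>2)))"
  note b = spectral_interval_bounds[OF k, folded c_def]
  have h: "continuous_on {1 - c..1 + c} h"
    unfolding h_def using b(4) by (intro continuous_intros) fastforce+
  have nn: "h x \<ge> 0" if "x \<in> {1 - c..1 + c}" for x
    unfolding h_def using b(3,4)[OF that] by (intro mult_nonneg_nonneg divide_nonneg_nonneg) auto
  have M: "?M = density lborel (\<lambda>x. ennreal (indicator {1 - c..1 + c} x * h x))"
    using spectral_measure_eq[OF k] by (simp add: h_def c_def)
  note * = density_Icc_integral[OF h nn continuous_on_const M, of "1 :: real"]
  have "((\<lambda>\<theta>. c * sin \<theta> * h (1 - c * cos \<theta>)) has_integral (\<integral>x. 1 \<partial>?M)) {0..pi}"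
    using cosine_substitution[OF _ h] c *(2) by simp
  moreover have "((\<lambda>\<theta>. c * sin \<theta> * h (1 - c * cos \<theta>)) has_integral
      (1 / pi * (poisson_sine_integral r 0 + poisson_sine_integral (- r) 0))) {0..pi}"
  proof (rule has_integral_eq[rotated])
    show "((\<lambda>\<theta>. 1 / pi * (poisson_sine r 0 \<theta> + poisson_sine (- r) 0 \<theta>)) has_integral
      (1 / pi * (poisson_sine_integral r 0 + poisson_sine_integral (- r) 0))) {0..pi}"
      unfolding poisson_sine_integral_def
      by (intro has_integral_mult_right has_integral_add integrable_integral integrable_continuous_real
        continuous_on_poisson_sine r)
    fix \<theta> assume \<theta>: "\<theta> \<in> {0..pi}"
    define y where "y = c * cos \<theta>"
    have "\<bar>y\<bar> \<le> c"
      using c mult_left_le[of "\<bar>cos \<theta>\<bar>" c] by (simp add: y_def abs_mult)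
    then have "\<bar>y\<bar> < 1" using c by linarith
    then have y: "1 + y > 0" "1 - y > 0" by auto
    have "1 - y\<^sup>2 = (1 + y) * (1 - y)" by (simp add: power2_eq_square algebra_simps)
    then have frac: "1 / (1 - y\<^sup>2) = (1 / (1 + y) + 1 / (1 - y)) / 2"
      using y by (simp add: add_frac_eq)
    have "1 / pi * (poisson_sine r 0 \<theta> + poisson_sine (- r) 0 \<theta>)
      = (sin \<theta>)\<^sup>2 / (4 * pi) * (4 / (1 + (1 * r)\<^sup>2 + 2 * (1 * r) * cos \<theta>) + 4 / (1 + ((- 1) * r)\<^sup>2 + 2 * ((- 1) * r) * cos \<theta>))"
      by (simp add: poisson_sine_def power2_eq_square ring_distribs)
    also have "\<dots> = (sin \<theta>)\<^sup>2 / (4 * pi) * (real k * c\<^sup>2 / (1 + 1 * c * cos \<theta>) + real k * c\<^sup>2 / (1 + (- 1) * c * cos \<theta>))"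
      unfolding c_def r_def by (subst (1 2) poisson_denominator_spectral[OF k]) simp_all
    also have "\<dots> = (sin \<theta>)\<^sup>2 * (real k * c\<^sup>2) / (2 * pi) * ((1 / (1 + y) + 1 / (1 - y)) / 2)"
    proof -
      have "s / (4 * pi) * (A / u + A / v) = s * A / (2 * pi) * ((1 / u + 1 / v) / 2)" for s A u v :: real
        unfolding divide_inverse inverse_mult_distrib by (simp add: algebra_simps)
      moreover have "1 + 1 * c * cos \<theta> = 1 + y" "1 + (- 1) * c * cos \<theta> = 1 - y"
        by (simp_all add: y_def)
      ultimately show ?thesis by (simp only:)
    qed
    also have "\<dots> = (sin \<theta>)\<^sup>2 * (real k * c\<^sup>2) / (2 * pi) * (1 / (1 - y\<^sup>2))"
      unfolding frac ..
    also have "\<dots> = c * sin \<theta> * h (1 - c * cos \<theta>)"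
      using sqrt_cosine_substitution[of c \<theta>] c \<theta>
      by (simp add: h_def y_def power2_eq_square mult_ac)
    finally show "1 / pi * (poisson_sine r 0 \<theta> + poisson_sine (- r) 0 \<theta>) = c * sin \<theta> * h (1 - c * cos \<theta>)" .
  qed
  ultimately have "(\<integral>x. 1 \<partial>?M) = 1 / pi * (poisson_sine_integral r 0 + poisson_sine_integral (- r) 0)"
    by (rule has_integral_unique)
  then have "measure ?M (space ?M) = 1"
    using poisson_sine_integral_0 r by simp
  moreover have "emeasure ?M (space ?M) < \<infinity>"
    using *(1) by (simp add: integrable_iff_bounded)
  ultimately show "emeasure ?M (space ?M) = 1"
    by (simp add: emeasure_eq_ennreal_measure)
qed


section \<open>Orthogonality and uniqueness\<close>

lemma poly_functional_integral:
  assumes int: "\<And>p. integrable M (poly p)"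
  shows "poly_functional (\<lambda>p. \<integral>x. poly p x \<partial>M)"
proof
  fix p q :: "real poly" and c :: real
  have "poly (p + q) = (\<lambda>x. poly p x + poly q x)" "poly (smult c p) = (\<lambda>x. c * poly p x)"
    by auto
  then show "(\<integral>x. poly (p + q) x \<partial>M) = (\<integral>x. poly p x \<partial>M) + (\<integral>x. poly q x \<partial>M)"
    and "(\<integral>x. poly (smult c p) x \<partial>M) = c * (\<integral>x. poly p x \<partial>M)"
    by (simp_all add: int)
qed

text \<open>This form mentions the measure only through the functional \<open>p \<mapsto> \<integral> p\<close>.\<close>

lemma orthogonal_polys_iff:
  "orthogonal_polys M P \<longleftrightarrow>
     (\<forall>p. integrable M (poly p)) \<and> (\<forall>t. degree (P t) = t) \<and>
     (\<forall>i j. i \<noteq> j \<longrightarrow> (\<integral>x. poly (P i * P j) x \<partial>M) = 0) \<and>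
     (\<forall>i. (\<integral>x. poly (P i * P i) x \<partial>M) > 0)"
  unfolding orthogonal_polys_def poly_mult power2_eq_square by (rule refl)

lemma Q_orthogonal:
  assumes k: "k \<ge> 3"
  shows "orthogonal_polys (weighted_spectral_measure k) (Q k)"
proof -
  let ?M = "weighted_spectral_measure k"
  have int: "integrable ?M (poly p)" for p
    by (intro weighted_spectral_measure_integral k continuous_intros)
  define L where "L = (\<lambda>p. \<integral>x. poly p x \<partial>?M)"
  interpret poly_functional L
    unfolding L_def by (rule poly_functional_integral) (rule int)
  define a b c where "a = (\<lambda>n. - delta k n)" and "b = (\<lambda>n. if n = 0 then 1 else delta k n)"
    and "c = (\<lambda>n. 1 - delta k (n + 1))"
  have Q0: "Q k 0 = 1" and Q1: "Q k 1 = [:b 0, a 0:]"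
    by (simp_all add: a_def b_def)
  have rec: "Q k (n + 2) = [:b (n + 1), a (n + 1):] * Q k (n + 1) + smult (c n) (Q k n)" for n
    by (simp add: a_def b_def c_def smult_add_right del: delta.simps)
  have a: "a n < 0" for n using delta_bounds(1)[OF k] by (simp add: a_def)
  then have a': "a n \<noteq> 0" for n by (metis less_irrefl)
  have c: "c n < 0" for n using delta_Suc_gt_1[OF k, of n] by (simp add: c_def del: delta.simps)
  have vanish: "L (Q k n) = 0" if "n > 0" for n
    using integral_Q[OF k, of n] that by (simp add: L_def)
  have deg: "degree (Q k n) = n" for n
    using recurrence_degree[of "Q k" b a c, OF Q0 Q1 rec a'] .
  have lower: "L (Q k i * Q k j) = 0" if "i < j" for i j
    using recurrence_annihilates_lower_degree[of "Q k" b a c, OF rec a' vanish] deg that by simp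
  have orth: "L (Q k i * Q k j) = 0" if "i \<noteq> j" for i j
    using lower[of i j] lower[of j i] that by (cases "i < j") (auto simp: mult.commute)
  have pos: "L (Q k n * Q k n) > 0" for n
  proof (induction n)
    case 0
    have "Q k 0 * Q k 0 = Q k 0" by simp
    moreover have "L (Q k 0) = 1"
      unfolding L_def integral_Q[OF k] by simp
    ultimately show ?case by (simp only: zero_less_one)
  next
    case (Suc n)
    have "- (a n * c n / a (n + 1)) > 0"
      using a c by (simp add: divide_neg_neg mult_neg_neg zero_less_mult_iff divide_less_0_iff)
    then show ?case
      using recurrence_norm[of "Q k" b a c, OF Q0 Q1 rec a' vanish, of n] Suc
      by (simp only: Suc_eq_plus1) (rule mult_pos_pos)
  qed
  show ?thesis
    using int deg orth pos by (auto simp: orthogonal_polys_iff L_def simp del: poly_mult)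
qed

lemma residual_orthogonal_polys_unique:
  assumes P: "residual_orthogonal_polys M P" and P': "residual_orthogonal_polys M P'"
  shows "P' = P"
proof
  fix n
  define L where "L = (\<lambda>p. \<integral>x. poly p x \<partial>M)"
  note defs = residual_orthogonal_polys_def orthogonal_polys_iff
  have int: "integrable M (poly p)" for p
    using P by (simp add: defs)
  interpret poly_functional L
    unfolding L_def by (rule poly_functional_integral) (rule int)
  have facts: "degree (R i) = i" "i \<noteq> j \<Longrightarrow> L (R i * R j) = 0" "L (R i * R i) \<noteq> 0"
    if "residual_orthogonal_polys M R" for R i j
    using that by (auto simp: defs L_def simp del: poly_mult) (metis less_irrefl)
  obtain s where s: "P' n = smult s (P n)"
    using orthogonal_sequences_proportional[of P P' n] facts[OF P] facts[OF P'] by metis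
  have "poly (P' n) 0 = 1" "poly (P n) 0 = 1"
    using P P' by (auto simp: defs)
  then show "P' n = P n" using s by simp
qed

theorem theorem5p1:
  fixes k :: nat
  assumes "k \<ge> 3"
  shows "prob_space (spectral_measure k) \<and>
    (\<forall>P. residual_orthogonal_polys (weighted_spectral_measure k) P \<longleftrightarrow> P = Q k)"
proof -
  have "residual_orthogonal_polys (weighted_spectral_measure k) (Q k)"
    using Q_orthogonal[OF assms] by (simp add: residual_orthogonal_polys_def)
  then show ?thesis
    using prob_space_spectral_measure[OF assms] residual_orthogonal_polys_unique by blast
qed

end
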